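(* Let $n\ge 1$ and $m\ge 0$ be integers, let $P=[P_1,\dots,P_n]^T:\mathbb{C}^{n+m}\to\mathbb{C}^n$ be a polynomial system with $d_i=\deg P_i$ and $D=\max_{1\le i\le n} d_i$, let $g_1,\dots,g_m:\mathbb{C}\to\mathbb{C}$ be analytic functions, and let $\sigma_1,\dots,\sigma_m\in\{1,\dots,n\}$. Define $\mathcal{F}:\mathbb{C}^{n+m}\to\mathbb{C}^{n+m}$ by \[ \mathcal{F}(x_1,\dots,x_n,y_1,\dots,y_m)=\begin{bmatrix} P(x_1,\dots,x_n,y_1,\dots,y_m)\\ y_1-g_1(x_{\sigma_1})\\ \vdots\\ y_m-g_m(x_{\sigma_m})\end{bmatrix}. \] Assume that each $g_i$ satisfies some nonzero linear homogeneous differential equation with constant complex coefficients. For each $i=1,\dots,m$ let $r_i$ be the smallest positive integer such that there is a nonzero linear function $\ell_i:\mathbb{C}^{r_i+1}\to\mathbb{C}$ with $\ell_i(g_i,g_i',\dots,g_i^{(r_i)})=0$, with $\ell_i$ normalized as $\ell_i(z_0,\dots,z_{r_i})=z_{r_i}-c_{i,r_i-1}z_{r_i-1}-\cdots-c_{i,0}z_0$, so that $g_i^{(r_i)}=\sum_{j=0}^{r_i-1}c_{i,j}\,g_i^{(j)}$. For $i=1,\dots,m$ and $z\in\mathbb{C}$ define \[ B_i(z)=\max\{|g_i(z)|,\dots,|g_i^{(r_i-1)}(z)|\}\quad\text{and}\quad C_i=\max\{1,|c_{i,0}|,\dots,|c_{i,r_i-1}|\}. \] Then, for any $(x,y)\in\mathbb{C}^{n+m}$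 such that the Jacobian matrix $D\mathcal{F}(x,y)$ is invertible, \[ \gamma(\mathcal{F},(x,y))\le \mu(\mathcal{F},(x,y))\left(\frac{D^{3/2}}{2\|(x,y)\|_1}+2\sum_{i=1}^m C_i^2\max\{1,\,r_i\cdot B_i(x_{\sigma_i})\}\right). \]
   Context: Vectors in $\mathbb{C}^N$ carry the standard Euclidean norm $\|\cdot\|$; matrices and multilinear maps carry the induced operator norm. For $X\in\mathbb{C}^N$, $\|X\|_1$ is defined by $\|X\|_1^2=1+\|X\|^2=1+\sum_{i=1}^N|X_i|^2$ (this is not the usual $\ell^1$ norm). For an analytic map $f:\mathbb{C}^N\to\mathbb{C}^N$ and a point $X$ at which the Jacobian $Df(X)$ is invertible, \[ \gamma(f,X)=\sup_{k\ge 2}\left\|\frac{Df(X)^{-1}D^kf(X)}{k!}\right\|^{\frac1{k-1}}, \] where $D^kf(X)$ is the $k$-th derivative of $f$ at $X$, viewed as a symmetric $k$-linear map. For a polynomial $g(X)=\sum_{|\rho|\le d}a_\rho X^\rho$ of degree $d$, $\|g\|^2=\frac1{d!}\sum_{|\rho|\le d}\rho!\,(d-|\rho|)!\,|a_\rho|^2$ (multi-index notation). For the polynomial system $P=[P_1,\dots,P_n]^T$, $\|P\|^2=\sum_{i=1}^n\|P_i\|^2$, with each $\|P_i\|$ computed using $d=d_i=\deg P_i$. $\Delta_{(d)}(x,y)$ is the $n\times n$ diagonal matrix with diagonal entries $d_i^{1/2}\,\|(x,y)\|_1^{d_i-1}$, $i=1,\dots,n$. $I_m$ is the $m\times m$ identity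 matrix. When $D\mathcal{F}(x,y)$ is invertible, \[ \mu(\mathcal{F},(x,y))=\max\left\{1,\ \left\|D\mathcal{F}(x,y)^{-1}\begin{bmatrix}\Delta_{(d)}(x,y)\|P\| & 0\\ 0& I_m\end{bmatrix}\right\|\right\}. \] *)

theory Defs
  imports "HOL-Analysis.Analysis" "HOL-Library.Poly_Mapping"
begin

text \<open>
  A polynomial in variables indexed by the finite type \<open>'N\<close> is an element of the monoid algebra
  \<open>('N \<Rightarrow>\<^sub>0 nat) \<Rightarrow>\<^sub>0 complex\<close>: the keys are the multi-indices \<open>\<rho>\<close> with \<open>a\<^sub>\<rho> \<noteq> 0\<close>.
\<close>

type_synonym 'N multi_index = "'N \<Rightarrow>\<^sub>0 nat"
type_synonym 'N cpoly = "'N multi_index \<Rightarrow>\<^sub>0 complex"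

definition mi_abs :: "'N::finite multi_index \<Rightarrow> nat" where
  "mi_abs \<rho> = (\<Sum>k\<in>UNIV. Poly_Mapping.lookup \<rho> k)"

definition mi_fact :: "'N::finite multi_index \<Rightarrow> real" where
  "mi_fact \<rho> = (\<Prod>k\<in>UNIV. fact (Poly_Mapping.lookup \<rho> k))"

definition poly_eval :: "'N::finite cpoly \<Rightarrow> complex^'N \<Rightarrow> complex" where
  "poly_eval p X = (\<Sum>\<rho>\<in>Poly_Mapping.keys p.
     Poly_Mapping.lookup p \<rho> * (\<Prod>k\<in>UNIV. (X $ k) ^ Poly_Mapping.lookup \<rho> k))"

text \<open>The zero polynomial gets degree \<open>0\<close>.\<close>

definition poly_deg :: "'N::finite cpoly \<Rightarrow> nat" where
  "poly_deg p = Max (insert 0 (mi_abs ` Poly_Mapping.keys p))"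

definition poly_norm :: "'N::finite cpoly \<Rightarrow> real" where
  "poly_norm p = sqrt (1 / fact (poly_deg p) *
     (\<Sum>\<rho>\<in>Poly_Mapping.keys p.
       mi_fact \<rho> * fact (poly_deg p - mi_abs \<rho>) * (cmod (Poly_Mapping.lookup p \<rho>))\<^sup>2))"

definition system_norm :: "nat \<Rightarrow> (nat \<Rightarrow> 'N::finite cpoly) \<Rightarrow> real" where
  "system_norm n P = sqrt (\<Sum>i=1..n. (poly_norm (P i))\<^sup>2)"

definition norm_one :: "complex^'N::finite \<Rightarrow> real" where
  "norm_one X = sqrt (1 + (norm X)\<^sup>2)"

text \<open>
  The \<open>k\<close>-th derivative as a \<open>k\<close>-linear map: \<open>D\<^sup>kf(X)(v\<^sub>1,\<dots>,v\<^sub>k)\<close> is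
  \<open>higher_deriv [v\<^sub>1,\<dots>,v\<^sub>k] f X\<close>, the derivative of \<open>Y \<mapsto> D\<^sup>k\<^sup>-\<^sup>1f(Y)(v\<^sub>2,\<dots>,v\<^sub>k)\<close> at \<open>X\<close>
  applied to \<open>v\<^sub>1\<close>.  The library's \<^const>\<open>frechet_derivative\<close> is the derivative over the
  reals; for an analytic map it is complex linear and coincides with the complex derivative.
\<close>

primrec higher_deriv ::
  "(complex^'N::finite) list \<Rightarrow> (complex^'N \<Rightarrow> complex^'N) \<Rightarrow> complex^'N \<Rightarrow> complex^'N" where
  "higher_deriv [] f = f"
| "higher_deriv (v # vs) f = (\<lambda>X. frechet_derivative (higher_deriv vs f) (at X) v)"

definition multilinear_norm :: "nat \<Rightarrow> ((complex^'N::finite) list \<Rightarrow> complex^'N) \<Rightarrow> real" where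
  "multilinear_norm k M =
     (SUP vs\<in>{vs. length vs = k \<and> (\<forall>v\<in>set vs. norm v \<le> 1)}. norm (M vs))"

definition matrix_norm :: "complex^'N^'N::finite \<Rightarrow> real" where
  "matrix_norm A = onorm ((*v) A)"

text \<open>\<^const>\<open>jacobian\<close> at a complex type is the matrix of complex partial derivatives of an
  analytic map.  The supremum is taken in the extended reals, so it is \<open>\<infinity>\<close> if the set is
  unbounded.\<close>

definition gamma_fn :: "(complex^'N::finite \<Rightarrow> complex^'N) \<Rightarrow> complex^'N \<Rightarrow> ereal" where
  "gamma_fn f X = (SUP k\<in>{2..}. ereal
     (multilinear_norm k
        (\<lambda>vs. (matrix_inv (jacobian f (at X)) *v higher_deriv vs f X) /\<^sub>R fact k)
      powr (1 / (real k - 1))))"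

text \<open>
  Coordinates of \<open>\<complex>\<^sup>n\<^sup>+\<^sup>m\<close> are indexed by a finite type \<open>'N\<close> together with an enumeration
  \<open>\<iota>\<close>, a bijection from \<open>{1..n+m}\<close> onto \<open>'N\<close>.  For \<open>X = (x,y)\<close> we have
  \<open>x\<^sub>i = X $ \<iota> i\<close> and \<open>y\<^sub>j = X $ \<iota> (n + j)\<close>.  In this way \<open>m = 0\<close> is allowed, which would not
  be the case if \<open>m\<close> were the cardinality of a type.
\<close>

definition position :: "nat \<Rightarrow> nat \<Rightarrow> (nat \<Rightarrow> 'N) \<Rightarrow> 'N \<Rightarrow> nat" where
  "position n m \<iota> k = inv_into {1..n+m} \<iota> k"

definition pe_system ::
  "nat \<Rightarrow> nat \<Rightarrow> (nat \<Rightarrow> 'N::finite) \<Rightarrow> (nat \<Rightarrow> 'N cpoly) \<Rightarrow> (nat \<Rightarrow> complex \<Rightarrow> complex) \<Rightarrow>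
    (nat \<Rightarrow> nat) \<Rightarrow> complex^'N \<Rightarrow> complex^'N" where
  "pe_system n m \<iota> P g \<sigma> X = (\<chi> k. let i = position n m \<iota> k in
     if i \<le> n then poly_eval (P i) X
     else X $ \<iota> i - g (i - n) (X $ \<iota> (\<sigma> (i - n))))"

text \<open>The block diagonal matrix with blocks \<open>\<Delta>\<^sub>(\<^sub>d\<^sub>)(x,y) \<parallel>P\<parallel>\<close> and \<open>I\<^sub>m\<close>.  For \<open>d\<^sub>i = 0\<close> the
  factor \<open>sqrt d\<^sub>i\<close> vanishes, so the truncated exponent \<open>d\<^sub>i - 1\<close> is harmless.\<close>

definition scaling_matrix ::
  "nat \<Rightarrow> nat \<Rightarrow> (nat \<Rightarrow> 'N::finite) \<Rightarrow> (nat \<Rightarrow> 'N cpoly) \<Rightarrow> complex^'N \<Rightarrow> complex^'N^'N" where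
  "scaling_matrix n m \<iota> P X = (\<chi> k l.
     if k \<noteq> l then 0
     else let i = position n m \<iota> k in
       if i \<le> n then
         complex_of_real
           (sqrt (real (poly_deg (P i))) * norm_one X ^ (poly_deg (P i) - 1) * system_norm n P)
       else 1)"

definition mu ::
  "nat \<Rightarrow> nat \<Rightarrow> (nat \<Rightarrow> 'N::finite) \<Rightarrow> (nat \<Rightarrow> 'N cpoly) \<Rightarrow> (nat \<Rightarrow> complex \<Rightarrow> complex) \<Rightarrow>
    (nat \<Rightarrow> nat) \<Rightarrow> complex^'N \<Rightarrow> real" where
  "mu n m \<iota> P g \<sigma> X =
     max 1 (matrix_norm
       (matrix_inv (jacobian (pe_system n m \<iota> P g \<sigma>) (at X)) ** scaling_matrix n m \<iota> P X))"

text \<open>\<open>g\<close> satisfies \<open>\<ell>(g, g', \<dots>, g\<^sup>(\<^sup>r\<^sup>)) = 0\<close> for some nonzero linear \<open>\<ell>\<close> on \<open>\<complex>\<^sup>r\<^sup>+\<^sup>1\<close>,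
  which is given by its coefficients \<open>a 0, \<dots>, a r\<close>.\<close>

definition satisfies_linear_ode :: "(complex \<Rightarrow> complex) \<Rightarrow> nat \<Rightarrow> bool" where
  "satisfies_linear_ode g r \<longleftrightarrow>
     (\<exists>a :: nat \<Rightarrow> complex. (\<exists>j\<le>r. a j \<noteq> 0) \<and> (\<forall>z. (\<Sum>j\<le>r. a j * (deriv ^^ j) g z) = 0))"

definition ode_order :: "(complex \<Rightarrow> complex) \<Rightarrow> nat" where
  "ode_order g = (LEAST r. 0 < r \<and> satisfies_linear_ode g r)"

definition B_bound :: "(complex \<Rightarrow> complex) \<Rightarrow> nat \<Rightarrow> complex \<Rightarrow> real" where
  "B_bound g r z = Max ((\<lambda>j. cmod ((deriv ^^ j) g z)) ` {..<r})"

definition C_bound :: "(nat \<Rightarrow> complex) \<Rightarrow> nat \<Rightarrow> real" where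
  "C_bound c r = Max (insert 1 ((\<lambda>j. cmod (c j)) ` {..<r}))"

end

theory Submission
  imports Defs "HOL-Complex_Analysis.Cauchy_Integral_Formula"
begin

text \<open>
  Write \<open>S\<close> for the scaling matrix.  It is invertible: a constant \<open>P\<^sub>i\<close> would give a zero row of
  the Jacobian, so every \<open>d\<^sub>i \<ge> 1\<close> and \<open>\<parallel>P\<parallel> > 0\<close>.  Hence
  \<open>D\<F>\<^sup>-\<^sup>1 D\<^sup>k\<F> / k! = (D\<F>\<^sup>-\<^sup>1 S) (S\<^sup>-\<^sup>1 D\<^sup>k\<F> / k!)\<close>, whose first factor is at most \<open>\<mu> \<le> \<mu>\<^sup>k\<^sup>-\<^sup>1\<close>.
  In the second factor, the polynomial rows are bounded by
  \<open>\<bar>D\<^sup>kP\<^sub>i(X)\<bar> \<le> d\<^sub>i (d\<^sub>i - 1) \<dots> (d\<^sub>i - k + 1) \<parallel>P\<^sub>i\<parallel> \<parallel>X\<parallel>\<^sub>1\<close> to the power \<open>d\<^sub>i - k\<close> on unit vectors; this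
  comes from viewing \<open>P\<^sub>i\<close> as a symmetric tensor, where differentiation is a contraction, and evaluation
  is iterated contraction with \<open>(1, X)\<close> by Euler's identity.  In the remaining rows, differentiating
  the differential equation gives \<open>\<bar>g\<^sup>(\<^sup>r\<^sup>+\<^sup>s\<^sup>)\<bar> \<le> (r C)\<^sup>s\<^sup>+\<^sup>1 B\<close>, and \<open>r\<^sup>s \<le> (r + s)!\<close>.  The bounds of all rows are
  \<open>(k-1)\<close>-st powers, and \<open>\<Sum> t\<^sub>i\<^sup>k\<^sup>-\<^sup>1 \<le> (\<Sum> t\<^sub>i)\<^sup>k\<^sup>-\<^sup>1\<close> for \<open>t\<^sub>i \<ge> 0\<close>.
\<close>

section \<open>The weighted norm of a polynomial\<close>

definition multi_indices :: "nat \<Rightarrow> 'N::finite multi_index set" where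
  "multi_indices d = {\<rho>. mi_abs \<rho> \<le> d}"

definition mono_eval :: "'N::finite multi_index \<Rightarrow> complex^'N \<Rightarrow> complex" where
  "mono_eval \<rho> X = (\<Prod>k\<in>UNIV. (X $ k) ^ Poly_Mapping.lookup \<rho> k)"

text \<open>Coefficients form an arbitrary function and \<open>d\<close> is a nominal degree, so a
  contraction lowers \<open>d\<close> by exactly one, whatever the true degree of the
  result.\<close>

definition coeff_eval :: "nat \<Rightarrow> ('N::finite multi_index \<Rightarrow> complex) \<Rightarrow> complex^'N \<Rightarrow> complex" where
  "coeff_eval d a X = (\<Sum>\<rho>\<in>multi_indices d. a \<rho> * mono_eval \<rho> X)"

text \<open>The inverse of the multinomial coefficient of \<rho> once a homogenizing variable with
  exponent \<open>d - mi_abs \<rho>\<close> is added. Accordingly \<open>bw_norm d\<close> is the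
  Bombieri-Weyl norm of the homogenization in degree \<open>d\<close>.\<close>

definition bw_weight :: "nat \<Rightarrow> 'N::finite multi_index \<Rightarrow> real" where
  "bw_weight d \<rho> = mi_fact \<rho> * fact (d - mi_abs \<rho>) / fact d"

definition bw_norm :: "nat \<Rightarrow> ('N::finite multi_index \<Rightarrow> complex) \<Rightarrow> real" where
  "bw_norm d a = sqrt (\<Sum>\<rho>\<in>multi_indices d. bw_weight d \<rho> * (cmod (a \<rho>))\<^sup>2)"

abbreviation unit_index :: "'N \<Rightarrow> 'N multi_index" where
  "unit_index k \<equiv> Poly_Mapping.single k (Suc 0)"

text \<open>The derivative along \<open>(v0, v)\<close> of the homogenization of degree
  \<open>Suc d\<close>, with the homogenizing variable set to 1 afterwards. The choice
  \<open>v0 = 0\<close> gives the ordinary derivative along \<open>v\<close>, and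
  \<open>(1, X)\<close> the one in Euler's identity.\<close>

definition contract ::
  "nat \<Rightarrow> complex \<Rightarrow> complex^'N::finite \<Rightarrow> ('N multi_index \<Rightarrow> complex) \<Rightarrow> 'N multi_index \<Rightarrow> complex"
  where "contract d v0 v a \<rho> = v0 * (of_nat (Suc d - mi_abs \<rho>) * a \<rho>) +
    (\<Sum>k\<in>UNIV. v $ k * (of_nat (Suc (Poly_Mapping.lookup \<rho> k)) * a (\<rho> + unit_index k)))"

section \<open>Unit shifts of multi-indices\<close>

lemma mi_abs_add_unit [simp]: "mi_abs (\<rho> + unit_index k) = Suc (mi_abs \<rho>)"
  by (simp add: mi_abs_def lookup_add lookup_single when_def sum.distrib)

lemma finite_multi_indices [simp]: "finite (multi_indices d)"
proof (rule finite_imageD)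
  show "inj_on Poly_Mapping.lookup (multi_indices d)"
    by (simp add: inj_on_def lookup_inject)
  have "Poly_Mapping.lookup ` multi_indices d \<subseteq> (UNIV :: 'a set) \<rightarrow>\<^sub>E {..d}"
  proof
    fix f assume "f \<in> Poly_Mapping.lookup ` (multi_indices d :: 'a multi_index set)"
    then obtain \<rho> :: "'a multi_index" where f: "f = Poly_Mapping.lookup \<rho>" and "mi_abs \<rho> \<le> d"
      by (auto simp: multi_indices_def)
    moreover have "f k \<le> mi_abs \<rho>" for k
      unfolding mi_abs_def f by (rule member_le_sum) auto
    ultimately have "f k \<le> d" for k
      using le_trans by blast
    then show "f \<in> UNIV \<rightarrow>\<^sub>E {..d}"
      by auto
  qed
  then show "finite (Poly_Mapping.lookup ` (multi_indices d :: 'a multi_index set))"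
    by (rule finite_subset) (simp add: finite_PiE)
qed

lemma mono_eval_add_unit: "mono_eval (\<rho> + unit_index k) X = X $ k * mono_eval \<rho> X"
proof -
  have "mono_eval (\<rho> + unit_index k) X =
      (\<Prod>l\<in>UNIV. (if l = k then X $ k else 1) * (X $ l) ^ Poly_Mapping.lookup \<rho> l)"
    unfolding mono_eval_def by (rule prod.cong) (auto simp: lookup_add lookup_single when_def)
  also have "\<dots> = X $ k * mono_eval \<rho> X"
    by (simp add: prod.distrib mono_eval_def)
  finally show ?thesis .
qed

lemma mi_fact_add_unit:
  "mi_fact (\<rho> + unit_index k) = real (Suc (Poly_Mapping.lookup \<rho> k)) * mi_fact \<rho>"
proof -
  have "mi_fact (\<rho> + unit_index k) =
      (\<Prod>l\<in>UNIV. (if l = k then real (Suc (Poly_Mapping.lookup \<rho> k)) else 1) *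
        fact (Poly_Mapping.lookup \<rho> l))"
    unfolding mi_fact_def by (rule prod.cong) (auto simp: lookup_add lookup_single when_def)
  also have "\<dots> = real (Suc (Poly_Mapping.lookup \<rho> k)) * mi_fact \<rho>"
    by (simp only: prod.distrib mi_fact_def) simp
  finally show ?thesis .
qed

lemma diff_unit_add_unit:
  assumes "Poly_Mapping.lookup \<tau> k \<noteq> 0"
  shows "\<tau> - unit_index k + unit_index k = \<tau>"
  using assms
  by (intro poly_mapping_eqI) (auto simp: lookup_add lookup_minus lookup_single when_def)

text \<open>The shift is a bijection onto the indices with positive \<open>k\<close>-th entry, and
  \<open>F\<close> vanishes at the others. In the uses below a factor
  \<open>Poly_Mapping.lookup \<tau> k\<close> provides this vanishing.\<close>

lemma sum_shift_unit:
  fixes F :: "'N::finite multi_index \<Rightarrow> 'b::comm_monoid_add"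
  assumes "\<And>\<tau>. Poly_Mapping.lookup \<tau> k = 0 \<Longrightarrow> F \<tau> = 0"
  shows "(\<Sum>\<rho>\<in>multi_indices d. F (\<rho> + unit_index k)) = (\<Sum>\<tau>\<in>multi_indices (Suc d). F \<tau>)"
proof -
  let ?S = "{\<tau>\<in>multi_indices (Suc d). Poly_Mapping.lookup \<tau> k \<noteq> 0}"
  have "(\<Sum>\<rho>\<in>multi_indices d. F (\<rho> + unit_index k)) = (\<Sum>\<tau>\<in>?S. F \<tau>)"
  proof (rule sum.reindex_bij_witness[where i = "\<lambda>\<tau>. \<tau> - unit_index k" and j = "\<lambda>\<rho>. \<rho> + unit_index k"])
    fix \<tau> assume \<tau>: "\<tau> \<in> ?S"
    then show eq: "\<tau> - unit_index k + unit_index k = \<tau>"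
      by (simp add: diff_unit_add_unit)
    then have "mi_abs \<tau> = Suc (mi_abs (\<tau> - unit_index k))"
      by (metis mi_abs_add_unit)
    with \<tau> show "\<tau> - unit_index k \<in> multi_indices d"
      by (simp add: multi_indices_def)
  qed (auto simp: multi_indices_def lookup_add)
  also have "\<dots> = (\<Sum>\<tau>\<in>multi_indices (Suc d). F \<tau>)"
    using assms by (intro sum.mono_neutral_left) auto
  finally show ?thesis .
qed

text \<open>The counterpart for the homogenizing variable: the factor
  \<open>Suc d - mi_abs \<tau>\<close> vanishes at the added indices.\<close>

lemma sum_multi_indices_Suc:
  fixes F :: "'N::finite multi_index \<Rightarrow> 'b::comm_monoid_add"
  assumes "\<And>\<tau>. mi_abs \<tau> = Suc d \<Longrightarrow> F \<tau> = 0"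
  shows "(\<Sum>\<rho>\<in>multi_indices d. F \<rho>) = (\<Sum>\<tau>\<in>multi_indices (Suc d). F \<tau>)"
  by (rule sum.mono_neutral_left[OF finite_multi_indices]) (auto simp: multi_indices_def intro!: assms)

section \<open>Weights and the norm of a contraction\<close>

lemma mi_fact_pos: "0 < mi_fact \<rho>"
  by (simp add: mi_fact_def prod_pos)

lemma bw_weight_pos: "0 < bw_weight d \<rho>"
  by (simp add: bw_weight_def mi_fact_pos)

lemma bw_norm_nonneg: "0 \<le> bw_norm d a"
  by (auto simp: bw_norm_def intro!: sum_nonneg mult_nonneg_nonneg less_imp_le[OF bw_weight_pos])

lemma bw_norm_power2: "(bw_norm d a)\<^sup>2 = (\<Sum>\<rho>\<in>multi_indices d. bw_weight d \<rho> * (cmod (a \<rho>))\<^sup>2)"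
  unfolding bw_norm_def
  by (rule real_sqrt_pow2) (auto intro!: sum_nonneg mult_nonneg_nonneg less_imp_le[OF bw_weight_pos])

text \<open>Raising one exponent, that of the homogenizing variable here and of variable
  \<open>k\<close> in the next lemma, multiplies the weight by the new exponent divided by
  \<open>Suc d\<close>.\<close>

lemma bw_weight_contract_0:
  assumes "mi_abs \<rho> \<le> d"
  shows "bw_weight d \<rho> * real (Suc d - mi_abs \<rho>) = real (Suc d) * bw_weight (Suc d) \<rho>"
  using assms by (simp add: bw_weight_def Suc_diff_le field_simps del: of_nat_Suc)

lemma bw_weight_contract_unit:
  "bw_weight d \<rho> * real (Suc (Poly_Mapping.lookup \<rho> k)) =
    real (Suc d) * bw_weight (Suc d) (\<rho> + unit_index k)"
  by (simp add: bw_weight_def mi_fact_add_unit field_simps del: of_nat_Suc)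

lemma cmod_Cauchy_Schwarz_sum:
  assumes "finite A"
  shows "(cmod (\<Sum>i\<in>A. u i * w i))\<^sup>2 \<le> (\<Sum>i\<in>A. (cmod (u i))\<^sup>2) * (\<Sum>i\<in>A. (cmod (w i))\<^sup>2)"
proof -
  have "cmod (\<Sum>i\<in>A. u i * w i) \<le> (\<Sum>i\<in>A. cmod (u i) * cmod (w i))"
    by (rule order_trans[OF norm_sum]) (simp add: norm_mult)
  then have "(cmod (\<Sum>i\<in>A. u i * w i))\<^sup>2 \<le> (\<Sum>i\<in>A. cmod (u i) * cmod (w i))\<^sup>2"
    by (rule power_mono) simp
  also have "\<dots> \<le> (\<Sum>i\<in>A. (cmod (u i))\<^sup>2) * (\<Sum>i\<in>A. (cmod (w i))\<^sup>2)"
    by (rule Cauchy_Schwarz_ineq_sum)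
  finally show ?thesis .
qed

text \<open>Cauchy-Schwarz over all coordinates, indexed by an option type whose \<open>None\<close>
  stands for the homogenizing one.\<close>

lemma cmod_contract_power2_le:
  "(cmod (contract d v0 v a \<rho>))\<^sup>2 \<le> ((cmod v0)\<^sup>2 + (norm v)\<^sup>2) *
     ((real (Suc d - mi_abs \<rho>))\<^sup>2 * (cmod (a \<rho>))\<^sup>2 +
      (\<Sum>k\<in>UNIV. (real (Suc (Poly_Mapping.lookup \<rho> k)))\<^sup>2 * (cmod (a (\<rho> + unit_index k)))\<^sup>2))"
proof -
  define u where "u = case_option v0 (vec_nth v)"
  define w where "w = case_option (of_nat (Suc d - mi_abs \<rho>) * a \<rho>)
    (\<lambda>k. of_nat (Suc (Poly_Mapping.lookup \<rho> k)) * a (\<rho> + unit_index k))"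
  have sum_option: "(\<Sum>i\<in>UNIV. h i) = h None + (\<Sum>k\<in>UNIV. h (Some k))"
    for h :: "'a option \<Rightarrow> 'b::comm_monoid_add"
    by (simp add: UNIV_option_conv sum.reindex)
  have "contract d v0 v a \<rho> = (\<Sum>i\<in>UNIV. u i * w i)"
    by (simp only: sum_option contract_def u_def w_def option.case)
  then have "(cmod (contract d v0 v a \<rho>))\<^sup>2 \<le>
      (\<Sum>i\<in>UNIV. (cmod (u i))\<^sup>2) * (\<Sum>i\<in>UNIV. (cmod (w i))\<^sup>2)"
    using cmod_Cauchy_Schwarz_sum[of UNIV u w] by simp
  also have "(\<Sum>i\<in>UNIV. (cmod (u i))\<^sup>2) = (cmod v0)\<^sup>2 + (norm v)\<^sup>2"
    by (simp add: sum_option u_def norm_vec_def L2_set_def sum_nonneg)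
  also have "(\<Sum>i\<in>UNIV. (cmod (w i))\<^sup>2) = (real (Suc d - mi_abs \<rho>))\<^sup>2 * (cmod (a \<rho>))\<^sup>2 +
      (\<Sum>k\<in>UNIV. (real (Suc (Poly_Mapping.lookup \<rho> k)))\<^sup>2 * (cmod (a (\<rho> + unit_index k)))\<^sup>2)"
    by (simp only: sum_option w_def option.case norm_mult power_mult_distrib norm_of_nat)
  finally show ?thesis .
qed

text \<open>Regard \<open>a\<close> as a symmetric \<open>(d+1)\<close>-tensor on \<open>\<complex>\<^sup>1\<^sup>+\<^sup>N\<close>, with Frobenius norm \<open>bw_norm (Suc d) a\<close>;
  then \<open>contract d v0 v a\<close> is \<open>d+1\<close> times its contraction with \<open>(v0, v)\<close>.\<close>

lemma bw_norm_contract_le: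
  "bw_norm d (contract d v0 v a) \<le> real (Suc d) * sqrt ((cmod v0)\<^sup>2 + (norm v)\<^sup>2) * bw_norm (Suc d) a"
proof -
  define V where "V = (cmod v0)\<^sup>2 + (norm v)\<^sup>2"
  have V: "0 \<le> V"
    by (simp add: V_def)
  let ?A = "\<lambda>\<tau>. bw_weight (Suc d) \<tau> * (cmod (a \<tau>))\<^sup>2"
  \<comment> \<open>One of the two factors \<open>Suc d - mi_abs \<rho>\<close> turns the weight
    into that of degree \<open>Suc d\<close>; the other survives and lets the sum run up to degree
    \<open>Suc d\<close>. In \<open>second\<close> the same happens for each variable.\<close>
  have first: "(\<Sum>\<rho>\<in>multi_indices d. bw_weight d \<rho> * ((real (Suc d - mi_abs \<rho>))\<^sup>2 * (cmod (a \<rho>))\<^sup>2)) =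
      (\<Sum>\<tau>\<in>multi_indices (Suc d). real (Suc d) * (real (Suc d - mi_abs \<tau>) * ?A \<tau>))"
  proof -
    have "(\<Sum>\<rho>\<in>multi_indices d. bw_weight d \<rho> * ((real (Suc d - mi_abs \<rho>))\<^sup>2 * (cmod (a \<rho>))\<^sup>2)) =
        (\<Sum>\<rho>\<in>multi_indices d. real (Suc d) * (real (Suc d - mi_abs \<rho>) * ?A \<rho>))"
    proof (rule sum.cong[OF refl])
      fix \<rho> :: "'a multi_index" assume "\<rho> \<in> multi_indices d"
      then have "bw_weight d \<rho> * real (Suc d - mi_abs \<rho>) = real (Suc d) * bw_weight (Suc d) \<rho>"
        by (intro bw_weight_contract_0) (simp add: multi_indices_def)
      then have "(bw_weight d \<rho> * real (Suc d - mi_abs \<rho>)) *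
            (real (Suc d - mi_abs \<rho>) * (cmod (a \<rho>))\<^sup>2) =
          (real (Suc d) * bw_weight (Suc d) \<rho>) * (real (Suc d - mi_abs \<rho>) * (cmod (a \<rho>))\<^sup>2)"
        by simp
      then show "bw_weight d \<rho> * ((real (Suc d - mi_abs \<rho>))\<^sup>2 * (cmod (a \<rho>))\<^sup>2) =
          real (Suc d) * (real (Suc d - mi_abs \<rho>) * ?A \<rho>)"
        by (simp only: power2_eq_square mult_ac)
    qed
    also have "\<dots> = (\<Sum>\<tau>\<in>multi_indices (Suc d). real (Suc d) * (real (Suc d - mi_abs \<tau>) * ?A \<tau>))"
      by (rule sum_multi_indices_Suc) simp
    finally show ?thesis .
  qed
  have second: "(\<Sum>\<rho>\<in>multi_indices d. bw_weight d \<rho> *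
        ((real (Suc (Poly_Mapping.lookup \<rho> k)))\<^sup>2 * (cmod (a (\<rho> + unit_index k)))\<^sup>2)) =
      (\<Sum>\<tau>\<in>multi_indices (Suc d). real (Suc d) * (real (Poly_Mapping.lookup \<tau> k) * ?A \<tau>))" for k
  proof -
    have "(\<Sum>\<rho>\<in>multi_indices d. bw_weight d \<rho> *
        ((real (Suc (Poly_Mapping.lookup \<rho> k)))\<^sup>2 * (cmod (a (\<rho> + unit_index k)))\<^sup>2)) =
      (\<Sum>\<rho>\<in>multi_indices d. real (Suc d) *
        (real (Poly_Mapping.lookup (\<rho> + unit_index k) k) * ?A (\<rho> + unit_index k)))"
    proof (rule sum.cong[OF refl])
      fix \<rho> :: "'a multi_index"
      have l: "Poly_Mapping.lookup (\<rho> + unit_index k) k = Suc (Poly_Mapping.lookup \<rho> k)"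
        by (simp add: lookup_add)
      have "(bw_weight d \<rho> * real (Suc (Poly_Mapping.lookup \<rho> k))) *
            (real (Suc (Poly_Mapping.lookup \<rho> k)) * (cmod (a (\<rho> + unit_index k)))\<^sup>2) =
          (real (Suc d) * bw_weight (Suc d) (\<rho> + unit_index k)) *
            (real (Suc (Poly_Mapping.lookup \<rho> k)) * (cmod (a (\<rho> + unit_index k)))\<^sup>2)"
        by (rule arg_cong[OF bw_weight_contract_unit])
      then show "bw_weight d \<rho> *
          ((real (Suc (Poly_Mapping.lookup \<rho> k)))\<^sup>2 * (cmod (a (\<rho> + unit_index k)))\<^sup>2) =
        real (Suc d) * (real (Poly_Mapping.lookup (\<rho> + unit_index k) k) * ?A (\<rho> + unit_index k))"
        by (simp only: l power2_eq_square mult_ac)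
    qed
    also have "\<dots> = (\<Sum>\<tau>\<in>multi_indices (Suc d). real (Suc d) * (real (Poly_Mapping.lookup \<tau> k) * ?A \<tau>))"
      by (rule sum_shift_unit) simp
    finally show ?thesis .
  qed
  have "(bw_norm d (contract d v0 v a))\<^sup>2 =
      (\<Sum>\<rho>\<in>multi_indices d. bw_weight d \<rho> * (cmod (contract d v0 v a \<rho>))\<^sup>2)"
    by (rule bw_norm_power2)
  also have "\<dots> \<le> (\<Sum>\<rho>\<in>multi_indices d. bw_weight d \<rho> * (V *
     ((real (Suc d - mi_abs \<rho>))\<^sup>2 * (cmod (a \<rho>))\<^sup>2 +
      (\<Sum>k\<in>UNIV. (real (Suc (Poly_Mapping.lookup \<rho> k)))\<^sup>2 * (cmod (a (\<rho> + unit_index k)))\<^sup>2))))"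
    unfolding V_def
    by (intro sum_mono mult_left_mono cmod_contract_power2_le less_imp_le[OF bw_weight_pos])
  also have "\<dots> = V * ((\<Sum>\<rho>\<in>multi_indices d. bw_weight d \<rho> * ((real (Suc d - mi_abs \<rho>))\<^sup>2 * (cmod (a \<rho>))\<^sup>2)) +
      (\<Sum>k\<in>UNIV. \<Sum>\<rho>\<in>multi_indices d. bw_weight d \<rho> *
        ((real (Suc (Poly_Mapping.lookup \<rho> k)))\<^sup>2 * (cmod (a (\<rho> + unit_index k)))\<^sup>2)))"
    by (subst sum.swap) (simp add: sum.distrib[symmetric] sum_distrib_left distrib_left mult.left_commute del: of_nat_Suc)
  also have "\<dots> = V * (\<Sum>\<tau>\<in>multi_indices (Suc d). real (Suc d) *
      ((real (Suc d - mi_abs \<tau>) + (\<Sum>k\<in>UNIV. real (Poly_Mapping.lookup \<tau> k))) * ?A \<tau>))"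
    unfolding first second
    by (subst sum.swap) (simp add: sum.distrib[symmetric] sum_distrib_left sum_distrib_right distrib_left distrib_right mult.left_commute del: of_nat_Suc)
  \<comment> \<open>The surviving factors are the exponents of all variables of the homogenization,
    and these add up to \<open>Suc d\<close>.\<close>
  also have "\<dots> = V * (\<Sum>\<tau>\<in>multi_indices (Suc d). (real (Suc d))\<^sup>2 * ?A \<tau>)"
  proof -
    have "real (Suc d - mi_abs \<tau>) + (\<Sum>k\<in>UNIV. real (Poly_Mapping.lookup \<tau> k)) = real (Suc d)"
      if "\<tau> \<in> multi_indices (Suc d)" for \<tau> :: "'a multi_index"
    proof -
      have "(\<Sum>k\<in>UNIV. real (Poly_Mapping.lookup \<tau> k)) = real (mi_abs \<tau>)"
        by (simp add: mi_abs_def)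
      with that show ?thesis
        by (simp add: multi_indices_def of_nat_diff)
    qed
    then show ?thesis
      by (simp add: power2_eq_square mult.assoc del: of_nat_Suc cong: sum.cong)
  qed
  also have "\<dots> = (real (Suc d) * sqrt V * bw_norm (Suc d) a)\<^sup>2"
    using V by (simp add: power_mult_distrib bw_norm_power2 sum_distrib_left[symmetric] del: of_nat_Suc)
  finally show ?thesis
    unfolding V_def by (rule power2_le_imp_le) (simp add: bw_norm_nonneg)
qed

section \<open>Euler's identity and evaluation\<close>

lemma euler_sum:
  "(\<Sum>\<rho>\<in>multi_indices d. of_nat (Suc (Poly_Mapping.lookup \<rho> k)) * a (\<rho> + unit_index k) *
      (X $ k * mono_eval \<rho> X)) =
    (\<Sum>\<tau>\<in>multi_indices (Suc d). of_nat (Poly_Mapping.lookup \<tau> k) * (a \<tau> * mono_eval \<tau> X))"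
proof -
  have "(\<Sum>\<rho>\<in>multi_indices d. of_nat (Suc (Poly_Mapping.lookup \<rho> k)) * a (\<rho> + unit_index k) *
      (X $ k * mono_eval \<rho> X)) = (\<Sum>\<rho>\<in>multi_indices d.
      of_nat (Poly_Mapping.lookup (\<rho> + unit_index k) k) *
        (a (\<rho> + unit_index k) * mono_eval (\<rho> + unit_index k) X))"
    by (rule sum.cong) (simp_all add: lookup_add mono_eval_add_unit mult.assoc del: of_nat_Suc)
  also have "\<dots> = (\<Sum>\<tau>\<in>multi_indices (Suc d). of_nat (Poly_Mapping.lookup \<tau> k) * (a \<tau> * mono_eval \<tau> X))"
    by (rule sum_shift_unit) simp
  finally show ?thesis .
qed

text \<open>Euler's identity for the homogenization at \<open>(1, X)\<close>: every monomial is
  multiplied by the sum of its exponents, including \<open>Suc d - mi_abs \<tau>\<close>.\<close>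

lemma coeff_eval_contract_self:
  "coeff_eval d (contract d 1 X a) X = of_nat (Suc d) * coeff_eval (Suc d) a X"
proof -
  let ?M = "\<lambda>\<tau>. a \<tau> * mono_eval \<tau> X"
  have "coeff_eval d (contract d 1 X a) X =
      (\<Sum>\<rho>\<in>multi_indices d. of_nat (Suc d - mi_abs \<rho>) * ?M \<rho>) +
      (\<Sum>k\<in>UNIV. \<Sum>\<rho>\<in>multi_indices d. of_nat (Suc (Poly_Mapping.lookup \<rho> k)) * a (\<rho> + unit_index k) *
        (X $ k * mono_eval \<rho> X))"
    by (subst sum.swap)
       (simp add: coeff_eval_def contract_def sum.distrib[symmetric] distrib_right distrib_left sum_distrib_left sum_distrib_right mult_ac del: of_nat_Suc)
  also have "\<dots> = (\<Sum>\<tau>\<in>multi_indices (Suc d). of_nat (Suc d - mi_abs \<tau>) * ?M \<tau>) +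
      (\<Sum>k\<in>UNIV. \<Sum>\<tau>\<in>multi_indices (Suc d). of_nat (Poly_Mapping.lookup \<tau> k) * ?M \<tau>)"
    unfolding euler_sum by (subst sum_multi_indices_Suc) simp_all
  also have "\<dots> = (\<Sum>\<tau>\<in>multi_indices (Suc d).
      (of_nat (Suc d - mi_abs \<tau>) + (\<Sum>k\<in>UNIV. of_nat (Poly_Mapping.lookup \<tau> k))) * ?M \<tau>)"
    by (subst sum.swap) (simp add: sum.distrib[symmetric] sum_distrib_right distrib_right del: of_nat_Suc)
  also have "\<dots> = (\<Sum>\<tau>\<in>multi_indices (Suc d). of_nat (Suc d) * ?M \<tau>)"
  proof (rule sum.cong[OF refl])
    fix \<tau> :: "'a multi_index" assume "\<tau> \<in> multi_indices (Suc d)"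
    then have "(Suc d - mi_abs \<tau>) + (\<Sum>k\<in>UNIV. Poly_Mapping.lookup \<tau> k) = Suc d"
      by (simp add: multi_indices_def mi_abs_def)
    then have "of_nat (Suc d - mi_abs \<tau>) + (\<Sum>k\<in>UNIV. of_nat (Poly_Mapping.lookup \<tau> k)) = (of_nat (Suc d) :: complex)"
      by (metis of_nat_add of_nat_sum)
    then show "(of_nat (Suc d - mi_abs \<tau>) + (\<Sum>k\<in>UNIV. of_nat (Poly_Mapping.lookup \<tau> k))) * ?M \<tau> = of_nat (Suc d) * ?M \<tau>"
      by simp
  qed
  finally show ?thesis
    by (simp add: coeff_eval_def sum_distrib_left)
qed

lemma norm_one_pos: "0 < norm_one X"
  by (simp add: norm_one_def add_pos_nonneg)

text \<open>Contraction with \<open>(1, X)\<close> costs the factor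
  \<open>Suc d * norm_one X\<close> in norm, and Euler's identity gives \<open>Suc d\<close> back,
  so each degree costs one factor \<open>norm_one X\<close>.\<close>

lemma cmod_coeff_eval_le: "cmod (coeff_eval d a X) \<le> bw_norm d a * norm_one X ^ d"
proof (induction d arbitrary: a)
  case 0
  have "mi_abs \<rho> = 0 \<longleftrightarrow> \<rho> = 0" for \<rho> :: "'a multi_index"
    by (auto simp: mi_abs_def intro: poly_mapping_eqI)
  then have "(multi_indices 0 :: 'a multi_index set) = {0}"
    by (auto simp: multi_indices_def)
  then show ?case
    by (simp add: coeff_eval_def bw_norm_def bw_weight_def mi_fact_def mono_eval_def mi_abs_def)
next
  case (Suc d)
  have "real (Suc d) * cmod (coeff_eval (Suc d) a X) = cmod (coeff_eval d (contract d 1 X a) X)"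
    unfolding coeff_eval_contract_self norm_mult norm_of_nat ..
  also have "\<dots> \<le> bw_norm d (contract d 1 X a) * norm_one X ^ d"
    by (rule Suc.IH)
  also have "\<dots> \<le> (real (Suc d) * norm_one X * bw_norm (Suc d) a) * norm_one X ^ d"
    using bw_norm_contract_le[of d 1 X a] norm_one_pos[of X]
    by (intro mult_right_mono) (simp_all add: norm_one_def)
  also have "\<dots> = real (Suc d) * (bw_norm (Suc d) a * norm_one X ^ Suc d)"
    by simp
  finally show ?case
    by (simp del: of_nat_Suc power_Suc)
qed

section \<open>Derivatives of polynomials\<close>

lemma has_derivative_mono_eval:
  "(mono_eval \<rho> has_derivative
     (\<lambda>v. \<Sum>k\<in>UNIV. v $ k * (of_nat (Poly_Mapping.lookup \<rho> k) * mono_eval (\<rho> - unit_index k) X))) (at X)"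
proof -
  have comp: "((\<lambda>X. (X $ k) ^ q) has_derivative (\<lambda>v. of_nat q * v $ k * (X $ k) ^ (q - 1))) (at X)"
    for k q and X :: "complex^'a"
    by (rule has_derivative_power) (rule bounded_linear_imp_has_derivative[OF bounded_linear_vec_nth])
  have "(mono_eval \<rho> has_derivative (\<lambda>v. \<Sum>k\<in>UNIV.
      (of_nat (Poly_Mapping.lookup \<rho> k) * v $ k * (X $ k) ^ (Poly_Mapping.lookup \<rho> k - 1)) *
      (\<Prod>j\<in>UNIV - {k}. (X $ j) ^ Poly_Mapping.lookup \<rho> j))) (at X)"
    unfolding mono_eval_def[abs_def] by (rule has_derivative_prod) (rule comp)
  \<comment> \<open>Both subtractions truncate at 0, so this also holds for exponent 0, where the
    coefficient in the derivative is 0.\<close>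
  moreover have "(X $ k) ^ (Poly_Mapping.lookup \<rho> k - 1) *
      (\<Prod>j\<in>UNIV - {k}. (X $ j) ^ Poly_Mapping.lookup \<rho> j) = mono_eval (\<rho> - unit_index k) X" for k
  proof -
    have "mono_eval (\<rho> - unit_index k) X = (X $ k) ^ Poly_Mapping.lookup (\<rho> - unit_index k) k *
        (\<Prod>j\<in>UNIV - {k}. (X $ j) ^ Poly_Mapping.lookup (\<rho> - unit_index k) j)"
      unfolding mono_eval_def by (rule prod.remove) auto
    also have "(\<Prod>j\<in>UNIV - {k}. (X $ j) ^ Poly_Mapping.lookup (\<rho> - unit_index k) j) =
        (\<Prod>j\<in>UNIV - {k}. (X $ j) ^ Poly_Mapping.lookup \<rho> j)"
      by (rule prod.cong) (auto simp: lookup_minus lookup_single)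
    finally show ?thesis
      by (simp add: lookup_minus)
  qed
  ultimately show ?thesis
    by (simp add: mult_ac)
qed

text \<open>The homogenizing variable stays fixed, hence the contraction with
  \<open>(0, v)\<close>.\<close>

lemma has_derivative_coeff_eval_Suc:
  "(coeff_eval (Suc d) a has_derivative (\<lambda>v. coeff_eval d (contract d 0 v a) X)) (at X)"
proof -
  have "(coeff_eval (Suc d) a has_derivative (\<lambda>v. \<Sum>\<tau>\<in>multi_indices (Suc d). a \<tau> * (\<Sum>k\<in>UNIV.
      v $ k * (of_nat (Poly_Mapping.lookup \<tau> k) * mono_eval (\<tau> - unit_index k) X)))) (at X)"
    unfolding coeff_eval_def[abs_def]
    by (intro has_derivative_sum has_derivative_mult_right has_derivative_mono_eval)
  moreover have "(\<Sum>\<tau>\<in>multi_indices (Suc d). a \<tau> * (\<Sum>k\<in>UNIV.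
      v $ k * (of_nat (Poly_Mapping.lookup \<tau> k) * mono_eval (\<tau> - unit_index k) X))) =
      coeff_eval d (contract d 0 v a) X" for v
  proof -
    have "(\<Sum>\<tau>\<in>multi_indices (Suc d). a \<tau> * (\<Sum>k\<in>UNIV.
        v $ k * (of_nat (Poly_Mapping.lookup \<tau> k) * mono_eval (\<tau> - unit_index k) X))) =
      (\<Sum>k\<in>UNIV. \<Sum>\<tau>\<in>multi_indices (Suc d).
        v $ k * (of_nat (Poly_Mapping.lookup \<tau> k) * (a \<tau> * mono_eval (\<tau> - unit_index k) X)))"
      by (subst sum.swap) (simp add: sum_distrib_left mult_ac)
    also have "\<dots> = (\<Sum>k\<in>UNIV. \<Sum>\<rho>\<in>multi_indices d.
        v $ k * (of_nat (Poly_Mapping.lookup (\<rho> + unit_index k) k) * (a (\<rho> + unit_index k) *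
          mono_eval (\<rho> + unit_index k - unit_index k) X)))"
      by (intro sum.cong[OF refl] sum_shift_unit[symmetric]) simp
    also have "\<dots> = (\<Sum>k\<in>UNIV. \<Sum>\<rho>\<in>multi_indices d.
        v $ k * (of_nat (Suc (Poly_Mapping.lookup \<rho> k)) * (a (\<rho> + unit_index k) * mono_eval \<rho> X)))"
      by (simp add: lookup_add del: of_nat_Suc)
    also have "\<dots> = coeff_eval d (contract d 0 v a) X"
      by (subst sum.swap) (simp add: coeff_eval_def contract_def sum_distrib_left sum_distrib_right mult_ac del: of_nat_Suc)
    finally show ?thesis .
  qed
  ultimately show ?thesis
    by simp
qed

lemma poly_eval_eq_coeff_eval: "poly_eval p = coeff_eval (poly_deg p) (Poly_Mapping.lookup p)"
  and poly_norm_eq_bw_norm: "poly_norm p = bw_norm (poly_deg p) (Poly_Mapping.lookup p)"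
proof -
  have sub: "Poly_Mapping.keys p \<subseteq> multi_indices (poly_deg p)"
    by (auto simp: multi_indices_def poly_deg_def)
  show "poly_eval p = coeff_eval (poly_deg p) (Poly_Mapping.lookup p)"
    unfolding poly_eval_def[abs_def] coeff_eval_def[abs_def] mono_eval_def
    by (intro ext sum.mono_neutral_left sub) (auto simp: in_keys_iff)
  have "(\<Sum>\<rho>\<in>Poly_Mapping.keys p. bw_weight (poly_deg p) \<rho> * (cmod (Poly_Mapping.lookup p \<rho>))\<^sup>2) =
      (\<Sum>\<rho>\<in>multi_indices (poly_deg p). bw_weight (poly_deg p) \<rho> * (cmod (Poly_Mapping.lookup p \<rho>))\<^sup>2)"
    by (intro sum.mono_neutral_left sub) (auto simp: in_keys_iff)
  then show "poly_norm p = bw_norm (poly_deg p) (Poly_Mapping.lookup p)"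
    by (simp add: poly_norm_def bw_norm_def bw_weight_def sum_distrib_left)
qed

text \<open>A positive degree rules out the zero polynomial, and all weights are positive.\<close>

lemma poly_norm_pos:
  assumes "0 < poly_deg p"
  shows "0 < poly_norm p"
proof -
  have "Poly_Mapping.keys p \<noteq> {}"
    using assms by (auto simp: poly_deg_def)
  then have "0 < (\<Sum>\<rho>\<in>Poly_Mapping.keys p.
       mi_fact \<rho> * fact (poly_deg p - mi_abs \<rho>) * (cmod (Poly_Mapping.lookup p \<rho>))\<^sup>2)"
    by (intro sum_pos) (auto simp: mi_fact_pos in_keys_iff)
  then show ?thesis
    by (simp add: poly_norm_def)
qed

section \<open>Higher derivatives of the system\<close>

text \<open>The head of the list is contracted last, in the order of
  \<open>higher_deriv\<close>.\<close>

primrec contract_list ::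
  "nat \<Rightarrow> (complex^'N::finite) list \<Rightarrow> ('N multi_index \<Rightarrow> complex) \<Rightarrow> 'N multi_index \<Rightarrow> complex" where
  "contract_list d [] a = a"
| "contract_list d (v # vs) a = contract (d - Suc (length vs)) 0 v (contract_list d vs a)"

text \<open>The cases are separated because \<open>d - length vs\<close> truncates at 0: further
  contractions would read \<open>a\<close> at indices of total degree above \<open>d\<close>, where
  it is arbitrary.\<close>

definition poly_derivs ::
  "nat \<Rightarrow> ('N::finite multi_index \<Rightarrow> complex) \<Rightarrow> (complex^'N) list \<Rightarrow> complex^'N \<Rightarrow> complex" where
  "poly_derivs d a vs X =
    (if length vs \<le> d then coeff_eval (d - length vs) (contract_list d vs a) X else 0)"

lemma has_derivative_coeff_eval_0: "(coeff_eval 0 a has_derivative (\<lambda>v. 0)) (at X)"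
proof -
  have "Poly_Mapping.lookup \<rho> k = 0" if "mi_abs \<rho> = 0" for \<rho> :: "'a multi_index" and k
    using that by (simp add: mi_abs_def)
  then have "coeff_eval 0 a = (\<lambda>X. \<Sum>\<rho>\<in>multi_indices 0. a \<rho>)"
    by (auto simp: coeff_eval_def mono_eval_def multi_indices_def fun_eq_iff intro!: sum.cong)
  then show ?thesis
    by simp
qed

lemma has_derivative_poly_derivs:
  "(poly_derivs d a vs has_derivative (\<lambda>v. poly_derivs d a (v # vs) X)) (at X)"
proof -
  consider "d < length vs" | "d = length vs" | "length vs < d"
    by linarith
  then show ?thesis
  proof cases
    case 1
    then show ?thesis
      by (simp add: poly_derivs_def[abs_def])
  next
    case 2
    then show ?thesis
      by (simp add: poly_derivs_def[abs_def] has_derivative_coeff_eval_0)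
  next
    case 3
    then have "d - length vs = Suc (d - Suc (length vs))"
      by simp
    with 3 show ?thesis
      using has_derivative_coeff_eval_Suc[of "d - Suc (length vs)" "contract_list d vs a" X]
      by (simp add: poly_derivs_def[abs_def])
  qed
qed

text \<open>Successive contractions cost \<open>d\<close>, \<open>d - 1\<close>, and so on; their
  product is a falling factorial, written as factorial times binomial coefficient.\<close>

lemma bw_norm_contract_list_le:
  assumes "length vs \<le> d" "\<forall>v\<in>set vs. norm v \<le> 1"
  shows "bw_norm (d - length vs) (contract_list d vs a) \<le>
    fact (length vs) * real (d choose length vs) * bw_norm d a"
  using assms
proof (induction vs)
  case (Cons v vs)
  let ?e = "d - Suc (length vs)"
  let ?N = "bw_norm (Suc ?e) (contract_list d vs a)"
  have e: "d - length vs = Suc ?e"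
    using Cons.prems by simp
  have "bw_norm ?e (contract ?e 0 v (contract_list d vs a)) \<le> real (Suc ?e) * norm v * ?N"
    using bw_norm_contract_le[of ?e 0 v "contract_list d vs a"] by simp
  also have "\<dots> \<le> real (Suc ?e) * 1 * ?N"
    using Cons.prems by (intro mult_right_mono mult_left_mono) (auto simp: bw_norm_nonneg)
  also have "\<dots> \<le> real (Suc ?e) * (fact (length vs) * real (d choose length vs) * bw_norm d a)"
    using Cons by (simp add: e del: of_nat_Suc)
  also have "\<dots> = fact (length vs) * (real (Suc ?e) * real (d choose length vs)) * bw_norm d a"
    by simp
  also have "real (Suc ?e) * real (d choose length vs) =
      real (Suc (length vs)) * real (d choose Suc (length vs))"
    by (metis e binomial_absorb_comp binomial_absorption of_nat_mult)
  finally show ?case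
    by (simp add: algebra_simps)
qed simp

lemma cmod_poly_derivs_le:
  assumes "\<forall>v\<in>set vs. norm v \<le> 1"
  shows "cmod (poly_derivs d a vs X) \<le> fact (length vs) * real (d choose length vs) * bw_norm d a *
    norm_one X ^ (d - length vs)"
proof (cases "length vs \<le> d")
  case True
  have "cmod (poly_derivs d a vs X) \<le>
      bw_norm (d - length vs) (contract_list d vs a) * norm_one X ^ (d - length vs)"
    using True cmod_coeff_eval_le by (simp add: poly_derivs_def)
  also have "\<dots> \<le> fact (length vs) * real (d choose length vs) * bw_norm d a *
      norm_one X ^ (d - length vs)"
    by (intro mult_right_mono bw_norm_contract_list_le True assms)
       (simp add: less_imp_le[OF norm_one_pos])
  finally show ?thesis .
qed (simp add: poly_derivs_def bw_norm_nonneg)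

text \<open>The ingredients are \<open>(d choose k) * fact k \<le> d ^ k\<close> and
  \<open>2 ^ (k - 1) \<le> fact k\<close>. One factor \<open>sqrt d\<close> is kept apart because it
  cancels against the scaling matrix.\<close>

lemma binomial_le_sqrt_powr:
  assumes "1 \<le> d" "2 \<le> k"
  shows "real (d choose k) \<le> sqrt (real d) * (real d powr (3/2) / 2) ^ (k - 1)"
proof -
  obtain j where k: "k = Suc (Suc j)"
    using assms(2) by (metis add_2_eq_Suc le_Suc_ex)
  have two: "2 ^ Suc j \<le> (fact k :: real)"
    unfolding k
  proof (induction j)
    case (Suc j)
    have "2 * 2 ^ Suc j \<le> real (Suc (Suc (Suc j))) * fact (Suc (Suc j))"
      by (intro mult_mono Suc.IH) auto
    then show ?case
      by simp
  qed simp
  have "real (d choose k) * 2 ^ Suc j \<le> real (d choose k) * fact k"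
    by (intro mult_left_mono two) simp
  also have "\<dots> \<le> real d ^ k"
    using binomial_fact_pow[of d k] by (metis of_nat_fact of_nat_le_iff of_nat_mult of_nat_power)
  also have "\<dots> = real d ^ Suc j * (sqrt (real d) * sqrt (real d))"
    by (simp add: k)
  \<comment> \<open>As \<open>1 \<le> sqrt d\<close>, one of the two roots may be raised to the
    power \<open>k - 1\<close>, which is \<open>Suc j\<close>.\<close>
  also have "\<dots> \<le> real d ^ Suc j * (sqrt (real d) * sqrt (real d) ^ Suc j)"
    using assms(1) by (intro mult_left_mono) (auto simp: one_le_power)
  also have "\<dots> = sqrt (real d) * (real d * sqrt (real d)) ^ Suc j"
    by (simp add: power_mult_distrib)
  also have "real d * sqrt (real d) = real d powr (3/2)"
    using assms(1) powr_add[of "real d" 1 "1/2"] by (simp add: powr_half_sqrt)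
  finally show ?thesis
    by (simp add: k power_divide field_simps)
qed

text \<open>The derivative carries the power \<open>d - k\<close> of \<open>norm_one X\<close> and
  the scaling the power \<open>d - 1\<close>, which leaves the power \<open>k - 1\<close> in the
  denominator. For \<open>k > d\<close> the derivative is zero.\<close>

lemma scaled_poly_derivs_le:
  assumes "1 \<le> d" "d \<le> D" "2 \<le> k" "length vs = k" "\<forall>v\<in>set vs. norm v \<le> 1" "0 < p"
  shows "cmod (poly_derivs d a vs X) / (sqrt (real d) * norm_one X ^ (d - 1) * p) / fact k \<le>
    bw_norm d a / p * (real D powr (3/2) / (2 * norm_one X)) ^ (k - 1)"
proof (cases "k \<le> d")
  case True
  let ?x = "norm_one X"
  have x: "0 < ?x"
    by (rule norm_one_pos)
  have sp: "?x ^ (d - 1) = ?x ^ (d - k) * ?x ^ (k - 1)"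
    using True assms(3) by (simp add: power_add[symmetric])
  have "cmod (poly_derivs d a vs X) \<le> fact k * real (d choose k) * bw_norm d a * ?x ^ (d - k)"
    using cmod_poly_derivs_le[OF assms(5), of d a X] assms(4) by simp
  also have "\<dots> \<le> fact k * (sqrt (real d) * (real d powr (3/2) / 2) ^ (k - 1)) * bw_norm d a * ?x ^ (d - k)"
    using x assms by (intro mult_right_mono mult_left_mono binomial_le_sqrt_powr) (auto simp: bw_norm_nonneg)
  also have "\<dots> \<le> fact k * (sqrt (real d) * (real D powr (3/2) / 2) ^ (k - 1)) * bw_norm d a * ?x ^ (d - k)"
    using x assms
    by (intro mult_right_mono mult_left_mono power_mono divide_right_mono powr_mono2) (auto simp: bw_norm_nonneg)
  also have "\<dots> = bw_norm d a / p * (real D powr (3/2) / (2 * ?x)) ^ (k - 1) * fact k *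
      (sqrt (real d) * ?x ^ (d - 1) * p)"
    unfolding sp using x assms(6) by (simp add: power_divide power_mult_distrib)
  finally show ?thesis
    using x assms by (simp add: pos_divide_le_eq mult_ac)
next
  case False
  then show ?thesis
    using assms norm_one_pos[of X]
    by (simp add: poly_derivs_def bw_norm_nonneg)
qed

text \<open>The iterated derivatives of \<open>X $ i - g (X $ s)\<close>. The \<open>case\<close>
  treats the linear term: the coordinate, then its differential, then zero.\<close>

definition exp_derivs ::
  "'N \<Rightarrow> 'N \<Rightarrow> (complex \<Rightarrow> complex) \<Rightarrow> (complex^'N::finite) list \<Rightarrow> complex^'N \<Rightarrow> complex" where
  "exp_derivs i s g vs X =
    (case vs of [] \<Rightarrow> X $ i | v # us \<Rightarrow> if us = [] then v $ i else 0) -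
    (deriv ^^ length vs) g (X $ s) * (\<Prod>v\<leftarrow>vs. v $ s)"

section \<open>Derivatives of the analytic rows and of the whole system\<close>

lemma has_field_derivative_higher_deriv:
  assumes "g analytic_on UNIV"
  shows "((deriv ^^ k) g has_field_derivative (deriv ^^ Suc k) g z) (at z)"
proof -
  have "(deriv ^^ k) g holomorphic_on UNIV"
    using assms by (simp add: analytic_on_open holomorphic_higher_deriv)
  then show ?thesis
    by (simp add: holomorphic_derivI)
qed

lemma has_derivative_exp_derivs:
  assumes "g analytic_on UNIV"
  shows "(exp_derivs i s g vs has_derivative (\<lambda>v. exp_derivs i s g (v # vs) X)) (at X)"
proof -
  have nth: "((\<lambda>X. X $ l) has_derivative (\<lambda>v. v $ l)) (at X)" for l :: 'a and X :: "complex^'a"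
    by (rule bounded_linear_imp_has_derivative[OF bounded_linear_vec_nth])
  have lin: "((\<lambda>X. case vs of [] \<Rightarrow> X $ i | v # us \<Rightarrow> if us = [] then v $ i else 0) has_derivative
      (\<lambda>v. if vs = [] then v $ i else 0)) (at X)"
    by (cases vs) (auto intro: nth)
  have "((\<lambda>X. (deriv ^^ length vs) g (X $ s)) has_derivative
      (\<lambda>v. (deriv ^^ Suc (length vs)) g (X $ s) * v $ s)) (at X)"
    using has_derivative_compose[OF nth[of s],
        of "(deriv ^^ length vs) g" "(*) ((deriv ^^ Suc (length vs)) g (X $ s))"]
      has_field_derivative_higher_deriv[OF assms] by (simp add: has_field_derivative_def)
  then have "((\<lambda>X. (deriv ^^ length vs) g (X $ s) * (\<Prod>v\<leftarrow>vs. v $ s)) has_derivative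
      (\<lambda>v. (deriv ^^ Suc (length vs)) g (X $ s) * v $ s * (\<Prod>v\<leftarrow>vs. v $ s))) (at X)"
    by (rule has_derivative_mult_left)
  from has_derivative_diff[OF lin this] show ?thesis
    by (simp add: exp_derivs_def[abs_def] mult.assoc)
qed

lemma has_derivative_vec_lambda:
  fixes f :: "'N::finite \<Rightarrow> 'a::real_normed_vector \<Rightarrow> 'b::euclidean_space"
  assumes "\<And>k. (f k has_derivative f' k) (at x)"
  shows "((\<lambda>x. \<chi> k. f k x) has_derivative (\<lambda>v. \<chi> k. f' k v)) (at x)"
  unfolding has_derivative_componentwise_within[where f = "\<lambda>x. \<chi> k. f k x"]
  using assms by (auto simp: Basis_vec_def inner_axis intro: has_derivative_inner_left)

definition pe_derivs ::
  "nat \<Rightarrow> nat \<Rightarrow> (nat \<Rightarrow> 'N::finite) \<Rightarrow> (nat \<Rightarrow> 'N cpoly) \<Rightarrow> (nat \<Rightarrow> complex \<Rightarrow> complex) \<Rightarrow>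
    (nat \<Rightarrow> nat) \<Rightarrow> (complex^'N) list \<Rightarrow> complex^'N \<Rightarrow> complex^'N" where
  "pe_derivs n m \<iota> P g \<sigma> vs X = (\<chi> k. let i = position n m \<iota> k in
     if i \<le> n then poly_derivs (poly_deg (P i)) (Poly_Mapping.lookup (P i)) vs X
     else exp_derivs (\<iota> i) (\<iota> (\<sigma> (i - n))) (g (i - n)) vs X)"

lemma position_mem:
  assumes "bij_betw \<iota> {1..n+m} UNIV"
  shows "position n m \<iota> k \<in> {1..n+m}" "\<iota> (position n m \<iota> k) = k"
  using assms unfolding position_def bij_betw_def
  by (auto intro: inv_into_into f_inv_into_f simp del: atLeastAtMost_iff)

lemma position_eq:
  assumes "bij_betw \<iota> {1..n+m} UNIV" "i \<in> {1..n+m}"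
  shows "position n m \<iota> (\<iota> i) = i"
  using assms unfolding position_def by (intro inv_into_f_f) (auto simp: bij_betw_def)

text \<open>Prepending a direction in \<open>pe_derivs\<close> yields a derivative in the sense of
  \<open>has_derivative\<close>, which determines \<open>frechet_derivative\<close>; the empty list
  gives the system itself.\<close>

lemma higher_deriv_pe_system:
  assumes \<iota>: "bij_betw \<iota> {1..n+m} UNIV"
    and g: "\<And>i. i \<in> {1..m} \<Longrightarrow> g i analytic_on UNIV"
  shows "higher_deriv vs (pe_system n m \<iota> P g \<sigma>) = pe_derivs n m \<iota> P g \<sigma> vs"
proof (induction vs)
  case Nil
  show ?case
    by (simp add: fun_eq_iff pe_system_def pe_derivs_def poly_derivs_def exp_derivs_def
        poly_eval_eq_coeff_eval Let_def)
next
  case (Cons v vs)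
  have "(pe_derivs n m \<iota> P g \<sigma> vs has_derivative (\<lambda>v. pe_derivs n m \<iota> P g \<sigma> (v # vs) X)) (at X)" for X
    unfolding pe_derivs_def[abs_def]
  proof (rule has_derivative_vec_lambda)
    fix k
    let ?i = "position n m \<iota> k"
    have "?i - n \<in> {1..m}" if "\<not> ?i \<le> n"
      using position_mem(1)[OF \<iota>, of k] that by auto
    then show "((\<lambda>X. let i = ?i in
        if i \<le> n then poly_derivs (poly_deg (P i)) (Poly_Mapping.lookup (P i)) vs X
        else exp_derivs (\<iota> i) (\<iota> (\<sigma> (i - n))) (g (i - n)) vs X) has_derivative
      (\<lambda>v. let i = ?i in
        if i \<le> n then poly_derivs (poly_deg (P i)) (Poly_Mapping.lookup (P i)) (v # vs) X
        else exp_derivs (\<iota> i) (\<iota> (\<sigma> (i - n))) (g (i - n)) (v # vs) X)) (at X)"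
      using has_derivative_poly_derivs has_derivative_exp_derivs[OF g[of "?i - n"]]
      by (cases "?i \<le> n") (simp_all add: Let_def)
  qed
  then have "frechet_derivative (pe_derivs n m \<iota> P g \<sigma> vs) (at X) =
      (\<lambda>v. pe_derivs n m \<iota> P g \<sigma> (v # vs) X)" for X
    by (rule frechet_derivative_at[symmetric])
  then show ?case
    by (simp add: Cons.IH)
qed

section \<open>Growth of solutions of linear differential equations\<close>

text \<open>Since the coefficients are constant, differentiating the equation only shifts the
  orders.\<close>

lemma higher_deriv_ode:
  assumes "g analytic_on UNIV" "\<And>z. (deriv ^^ r) g z = (\<Sum>j<r. c j * (deriv ^^ j) g z)"
  shows "(deriv ^^ (r + s)) g z = (\<Sum>j<r. c j * (deriv ^^ (j + s)) g z)"
proof (induction s arbitrary: z)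
  case (Suc s)
  have "((\<lambda>z. \<Sum>j<r. c j * (deriv ^^ (j + s)) g z) has_field_derivative
      (\<Sum>j<r. c j * (deriv ^^ Suc (j + s)) g z)) (at z)"
    by (intro DERIV_sum DERIV_cmult has_field_derivative_higher_deriv assms(1))
  then have "deriv (\<lambda>z. \<Sum>j<r. c j * (deriv ^^ (j + s)) g z) z =
      (\<Sum>j<r. c j * (deriv ^^ (j + Suc s)) g z)"
    by (simp add: DERIV_imp_deriv)
  moreover have "(deriv ^^ (r + s)) g = (\<lambda>z. \<Sum>j<r. c j * (deriv ^^ (j + s)) g z)"
    using Suc.IH by (rule ext)
  ultimately show ?case
    by simp
qed (simp add: assms(2))

lemma C_bound_ge: "1 \<le> C_bound c r" "j < r \<Longrightarrow> cmod (c j) \<le> C_bound c r"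
  by (auto simp: C_bound_def)

lemma B_bound_ge: "j < r \<Longrightarrow> cmod ((deriv ^^ j) g z) \<le> B_bound g r z"
  by (auto simp: B_bound_def)

text \<open>Each derivative of order at least \<open>r\<close> combines the \<open>r\<close>
  preceding ones with coefficients at most \<open>C_bound c r\<close>, so one more order costs a
  factor \<open>r * C_bound c r\<close>. All orders below \<open>r + s\<close> are bounded at once,
  because the recursion reaches \<open>r\<close> steps back.\<close>

lemma higher_deriv_growth:
  assumes "g analytic_on UNIV" "\<And>z. (deriv ^^ r) g z = (\<Sum>j<r. c j * (deriv ^^ j) g z)"
    and "0 < r" "j < r + s"
  shows "cmod ((deriv ^^ j) g z) \<le> (real r * C_bound c r) ^ s * B_bound g r z"
  using assms(4)
proof (induction s arbitrary: j)
  case (Suc s)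
  let ?B = "B_bound g r z" and ?C = "C_bound c r"
  have C: "1 \<le> ?C" and B: "0 \<le> ?B"
    using C_bound_ge(1) B_bound_ge[OF assms(3), of g z] norm_ge_zero order_trans by blast+
  have K: "1 \<le> real r * ?C"
    using mult_mono[of 1 "real r" 1 ?C] C assms(3) by simp
  show ?case
  proof (cases "j < r + s")
    case True
    have "cmod ((deriv ^^ j) g z) \<le> (real r * ?C) ^ s * ?B"
      by (rule Suc.IH[OF True])
    also have "\<dots> \<le> (real r * ?C) ^ Suc s * ?B"
      using K B by (intro mult_right_mono power_increasing) auto
    finally show ?thesis .
  next
    case False
    with Suc.prems have j: "j = r + s"
      by simp
    have "cmod ((deriv ^^ j) g z) \<le> (\<Sum>i<r. cmod (c i * (deriv ^^ (i + s)) g z))"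
      unfolding j higher_deriv_ode[OF assms(1,2)] by (rule norm_sum)
    also have "\<dots> \<le> (\<Sum>i<r. ?C * ((real r * ?C) ^ s * ?B))"
      unfolding norm_mult using C by (intro sum_mono mult_mono C_bound_ge Suc.IH) auto
    also have "\<dots> = (real r * ?C) ^ Suc s * ?B"
      by (simp add: mult_ac)
    finally show ?thesis .
  qed
qed (simp add: B_bound_ge)

text \<open>For \<open>k < r\<close> the derivative occurs in \<open>B_bound\<close>. For
  \<open>k = r + s\<close> the growth bound has \<open>s + 1\<close> factors \<open>r\<close>: one
  is kept with \<open>B_bound\<close>, and the remaining \<open>r ^ s\<close> is paid for by
  \<open>fact k\<close>.\<close>

lemma higher_deriv_fact_le:
  assumes "g analytic_on UNIV" "\<And>z. (deriv ^^ r) g z = (\<Sum>j<r. c j * (deriv ^^ j) g z)"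
    and "0 < r" "2 \<le> k"
  shows "cmod ((deriv ^^ k) g z) / fact k \<le>
    (2 * ((C_bound c r)\<^sup>2 * max 1 (real r * B_bound g r z))) ^ (k - 1)"
proof -
  let ?B = "B_bound g r z" and ?C = "C_bound c r"
  define M where "M = max 1 (real r * ?B)"
  have C: "1 \<le> ?C" and B: "0 \<le> ?B" and M: "1 \<le> M" "real r * ?B \<le> M"
    using C_bound_ge(1) B_bound_ge[OF assms(3), of g z] norm_ge_zero order_trans
    by (blast, blast, auto simp: M_def)
  have MM: "M \<le> M ^ (k - 1)"
    using M(1) assms(4) power_increasing[of 1 "k - 1" M] by simp
  have step: "cmod ((deriv ^^ k) g z) \<le> fact k * (?C ^ (2 * (k - 1)) * M ^ (k - 1))"
  proof (cases "k < r")
    case True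
    have "cmod ((deriv ^^ k) g z) \<le> 1 * ?B"
      using B_bound_ge[OF True] by simp
    also have "\<dots> \<le> real r * ?B"
      using B assms(3) by (intro mult_right_mono) auto
    also have "\<dots> \<le> 1 * (1 * M ^ (k - 1))"
      using M MM by simp
    also have "\<dots> \<le> fact k * (?C ^ (2 * (k - 1)) * M ^ (k - 1))"
      using C M by (intro mult_mono) (auto simp: one_le_power)
    finally show ?thesis .
  next
    case False
    define s where "s = k - r"
    have k: "k = r + s"
      using False by (simp add: s_def)
    have r_pow: "real r ^ s \<le> fact k"
    proof -
      \<comment> \<open>Each of the \<open>s\<close> further factors of the factorial exceeds
        \<open>r\<close>.\<close>
      have "real r ^ s * fact r \<le> fact (r + s)"
      proof (induction s)
        case (Suc s)
        have "real r * (real r ^ s * fact r) \<le> real (Suc (r + s)) * fact (r + s)"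
          by (intro mult_mono Suc.IH) auto
        then show ?case
          by (simp add: mult_ac)
      qed simp
      moreover have "real r ^ s * 1 \<le> real r ^ s * fact r"
        by (intro mult_left_mono) auto
      ultimately show ?thesis
        unfolding k by linarith
    qed
    have "cmod ((deriv ^^ k) g z) \<le> (real r * ?C) ^ Suc s * ?B"
      by (rule higher_deriv_growth[OF assms(1-3)]) (simp add: k)
    also have "\<dots> = real r ^ s * (?C ^ Suc s * (real r * ?B))"
      by (simp add: power_mult_distrib)
    \<comment> \<open>The exponents compare as \<open>s + 1 \<le> k \<le> 2 * (k - 1)\<close>, by
      \<open>1 \<le> r\<close> and \<open>2 \<le> k\<close>.\<close>
    also have "\<dots> \<le> fact k * (?C ^ (2 * (k - 1)) * M ^ (k - 1))"
      using C B M MM r_pow assms(3,4)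
      by (intro mult_mono power_increasing) (auto simp: k)
    finally show ?thesis .
  qed
  have "cmod ((deriv ^^ k) g z) / fact k \<le> 1 * (?C ^ (2 * (k - 1)) * M ^ (k - 1))"
    using step by (simp add: pos_divide_le_eq mult_ac)
  also have "\<dots> \<le> 2 ^ (k - 1) * (?C ^ (2 * (k - 1)) * M ^ (k - 1))"
    using C M by (intro mult_right_mono) (auto simp: one_le_power)
  also have "\<dots> = (2 * (?C\<^sup>2 * M)) ^ (k - 1)"
    by (simp add: power_mult_distrib power_mult)
  finally show ?thesis
    by (simp add: M_def)
qed

text \<open>\<open>LEAST\<close> is only informative once a positive order is known to exist. As
  \<open>s\<close> may be 0, the relation is padded with a zero coefficient to order
  \<open>Suc s\<close>.\<close>

lemma ode_order_pos:
  assumes "satisfies_linear_ode g s"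
  shows "0 < ode_order g"
proof -
  obtain a where a: "\<exists>j\<le>s. a j \<noteq> 0" "\<And>z. (\<Sum>j\<le>s. a j * (deriv ^^ j) g z) = 0"
    using assms unfolding satisfies_linear_ode_def by blast
  let ?a = "a(Suc s := 0)"
  have "(\<Sum>j\<le>Suc s. ?a j * (deriv ^^ j) g z) = 0" for z
  proof -
    have "(\<Sum>j\<le>Suc s. ?a j * (deriv ^^ j) g z) = (\<Sum>j\<le>s. ?a j * (deriv ^^ j) g z)"
      by simp
    also have "\<dots> = (\<Sum>j\<le>s. a j * (deriv ^^ j) g z)"
      by (rule sum.cong) auto
    finally show ?thesis
      by (simp only: a(2))
  qed
  moreover have "\<exists>j\<le>Suc s. ?a j \<noteq> 0"
    using a(1) by (metis fun_upd_other le_SucI not_less_eq_eq order_refl)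
  ultimately have "satisfies_linear_ode g (Suc s)"
    unfolding satisfies_linear_ode_def by blast
  then have "0 < Suc s \<and> satisfies_linear_ode g (Suc s)"
    by simp
  then show ?thesis
    unfolding ode_order_def by (rule LeastI2) simp
qed

section \<open>The bound on gamma\<close>

lemma matrix_inv_right_eq: "invertible A \<Longrightarrow> A ** matrix_inv A = mat 1"
  unfolding invertible_def matrix_inv_def by (rule someI2_ex) auto

lemma power_powr_inverse:
  fixes x :: real
  assumes "0 \<le> x" "2 \<le> k"
  shows "(x ^ (k - 1)) powr (1 / (real k - 1)) = x"
proof (cases "x = 0")
  case True
  have "k - 1 \<noteq> 0"
    using assms(2) by linarith
  with True show ?thesis
    by (simp add: power_0_left)
next
  case False
  have "real (k - 1) = real k - 1" "real k - 1 \<noteq> 0"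
    using assms(2) by auto
  with False assms(1) show ?thesis
    by (simp add: powr_realpow[symmetric] powr_powr)
qed

text \<open>The first block keeps its Euclidean norm, so that the squares of the polynomial norms
  can be summed; the second is bounded by the sum of its entries.\<close>

lemma norm_le_split:
  fixes \<iota> :: "nat \<Rightarrow> 'N::finite" and w :: "complex^'N"
  assumes \<iota>: "bij_betw \<iota> {1..n+m} (UNIV :: 'N set)"
    and a: "(\<Sum>i=1..n. (cmod (w $ \<iota> i))\<^sup>2) \<le> a\<^sup>2"
    and b: "\<And>j. j \<in> {1..m} \<Longrightarrow> cmod (w $ \<iota> (n + j)) \<le> b j"
    and "0 \<le> a"
  shows "norm w \<le> a + (\<Sum>j=1..m. b j)"
proof -
  let ?b = "\<Sum>j=1..m. b j"
  have b0: "0 \<le> ?b"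
    by (intro sum_nonneg order_trans[OF norm_ge_zero b])
  have "(norm w)\<^sup>2 = (\<Sum>k\<in>UNIV. (cmod (w $ k))\<^sup>2)"
    by (simp add: norm_vec_def L2_set_def sum_nonneg)
  also have "\<dots> = (\<Sum>i=1..n+m. (cmod (w $ \<iota> i))\<^sup>2)"
    by (rule sum.reindex_bij_betw[OF \<iota>, symmetric])
  also have "\<dots> = (\<Sum>i=1..n. (cmod (w $ \<iota> i))\<^sup>2) + (\<Sum>j=1..m. (cmod (w $ \<iota> (n + j)))\<^sup>2)"
  proof -
    have "(\<Sum>i=n+1..n+m. (cmod (w $ \<iota> i))\<^sup>2) = (\<Sum>j=1..m. (cmod (w $ \<iota> (n + j)))\<^sup>2)"
      using sum.shift_bounds_cl_nat_ivl[of "\<lambda>i. (cmod (w $ \<iota> i))\<^sup>2" 1 n m]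
      by (simp only: add.commute)
    then show ?thesis
      by (subst sum.ub_add_nat) simp_all
  qed
  also have "(\<Sum>j=1..m. (cmod (w $ \<iota> (n + j)))\<^sup>2) \<le> ?b\<^sup>2"
  proof -
    have "L2_set (\<lambda>j. cmod (w $ \<iota> (n + j))) {1..m} \<le> (\<Sum>j=1..m. cmod (w $ \<iota> (n + j)))"
      by (rule L2_set_le_sum) simp
    also have "\<dots> \<le> ?b"
      by (intro sum_mono b)
    finally show ?thesis
      unfolding L2_set_def by (rule sqrt_le_D)
  qed
  also have "(\<Sum>i=1..n. (cmod (w $ \<iota> i))\<^sup>2) \<le> a\<^sup>2"
    by (rule a)
  also have "a\<^sup>2 + ?b\<^sup>2 \<le> (a + ?b)\<^sup>2"
    using \<open>0 \<le> a\<close> b0 by (simp add: power2_sum)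
  finally show ?thesis
    using \<open>0 \<le> a\<close> b0 by (intro power2_le_imp_le[of "norm w"]) simp_all
qed


theorem theorem2p3:
  fixes n m :: nat
    and \<iota> :: "nat \<Rightarrow> 'N::finite"
    and P :: "nat \<Rightarrow> 'N cpoly"
    and g :: "nat \<Rightarrow> complex \<Rightarrow> complex"
    and \<sigma> :: "nat \<Rightarrow> nat"
    and d :: "nat \<Rightarrow> nat" and D :: nat
    and r :: "nat \<Rightarrow> nat"
    and c :: "nat \<Rightarrow> nat \<Rightarrow> complex"
    and X :: "complex^'N"
  assumes "1 \<le> n"
    and "bij_betw \<iota> {1..n+m} (UNIV :: 'N set)"
    and "\<And>i. i \<in> {1..n} \<Longrightarrow> d i = poly_deg (P i)"
    and "D = Max (d ` {1..n})"
    and "\<And>i. i \<in> {1..m} \<Longrightarrow> g i analytic_on UNIV"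
    and "\<And>i. i \<in> {1..m} \<Longrightarrow> \<sigma> i \<in> {1..n}"
    and "\<And>i. i \<in> {1..m} \<Longrightarrow> \<exists>s. satisfies_linear_ode (g i) s"
    and "\<And>i. i \<in> {1..m} \<Longrightarrow> r i = ode_order (g i)"
    and "\<And>i z. i \<in> {1..m} \<Longrightarrow>
           (deriv ^^ r i) (g i) z = (\<Sum>j<r i. c i j * (deriv ^^ j) (g i) z)"
    and "invertible (jacobian (pe_system n m \<iota> P g \<sigma>) (at X))"
  shows "gamma_fn (pe_system n m \<iota> P g \<sigma>) X \<le>
    ereal (mu n m \<iota> P g \<sigma> X *
      (real D powr (3/2) / (2 * norm_one X) +
       2 * (\<Sum>i=1..m. (C_bound (c i) (r i))\<^sup>2 *
                      max 1 (real (r i) * B_bound (g i) (r i) (X $ \<iota> (\<sigma> i))))))"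
proof -
  let ?F = "pe_system n m \<iota> P g \<sigma>"
  let ?p = "system_norm n P"
  let ?\<mu> = "mu n m \<iota> P g \<sigma> X"
  let ?S = "scaling_matrix n m \<iota> P X"
  let ?L = "matrix_inv (jacobian ?F (at X))"
  \<comment> \<open>\<open>A\<close> and the \<open>\<beta> i\<close> are the bases of the powers
    that bound the polynomial block and the analytic rows; \<open>T\<close> is the bracket of the
    claim.\<close>
  define A where "A = real D powr (3/2) / (2 * norm_one X)"
  define \<beta> where "\<beta> i = 2 * ((C_bound (c i) (r i))\<^sup>2 *
    max 1 (real (r i) * B_bound (g i) (r i) (X $ \<iota> (\<sigma> i))))" for i
  define T where "T = A + (\<Sum>i=1..m. \<beta> i)"
  note \<iota> = assms(2)
  have A: "0 \<le> A"
    using norm_one_pos[of X] by (simp add: A_def)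
  have \<beta>: "0 \<le> \<beta> i" for i
    by (simp add: \<beta>_def)
  have T: "A \<le> T" "0 \<le> T" "\<And>i. i \<in> {1..m} \<Longrightarrow> \<beta> i \<le> T"
  proof -
    show "A \<le> T" "0 \<le> T"
      using A \<beta> by (auto simp: T_def intro!: sum_nonneg add_nonneg_nonneg)
    fix i assume "i \<in> {1..m}"
    then have "\<beta> i \<le> (\<Sum>i=1..m. \<beta> i)"
      using \<beta> by (intro member_le_sum) auto
    with A show "\<beta> i \<le> T"
      by (simp add: T_def)
  qed
  have hd: "higher_deriv vs ?F Y = pe_derivs n m \<iota> P g \<sigma> vs Y" for vs Y
    by (rule fun_cong[OF higher_deriv_pe_system[OF \<iota> assms(5)]])
  have hd_poly: "higher_deriv vs ?F X $ \<iota> i =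
      poly_derivs (poly_deg (P i)) (Poly_Mapping.lookup (P i)) vs X" if "i \<in> {1..n}" for vs i
  proof -
    have "position n m \<iota> (\<iota> i) = i"
      using that by (intro position_eq \<iota>) auto
    with that show ?thesis
      by (simp add: hd pe_derivs_def)
  qed
  have hd_exp: "higher_deriv vs ?F X $ \<iota> (n + j) = exp_derivs (\<iota> (n + j)) (\<iota> (\<sigma> j)) (g j) vs X"
    if "j \<in> {1..m}" for vs j
  proof -
    have "position n m \<iota> (\<iota> (n + j)) = n + j"
      using that by (intro position_eq \<iota>) auto
    with that show ?thesis
      by (simp add: hd pe_derivs_def)
  qed
  have d_pos: "1 \<le> poly_deg (P i)" if i: "i \<in> {1..n}" for i
  proof (rule ccontr)
    assume "\<not> 1 \<le> poly_deg (P i)"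
    then have "higher_deriv [v] ?F X $ \<iota> i = 0" for v
      unfolding hd_poly[OF i] by (simp add: poly_derivs_def)
    \<comment> \<open>For a single direction, \<open>higher_deriv\<close> is the Frechet derivative
      that defines \<open>jacobian\<close>.\<close>
    then have "jacobian ?F (at X) $ \<iota> i $ l = 0" for l
      by (simp add: jacobian_def matrix_def)
    moreover have "(jacobian ?F (at X) ** ?L) $ \<iota> i $ \<iota> i = 1"
      using matrix_inv_right_eq[OF assms(10)] by (simp add: mat_def)
    ultimately show False
      by (simp add: matrix_matrix_mult_def)
  qed
  have p_pos: "0 < ?p"
  proof -
    have "0 < (poly_norm (P i))\<^sup>2" if "i \<in> {1..n}" for i
      using poly_norm_pos[of "P i"] d_pos[OF that] by simp
    then have "0 < (\<Sum>i=1..n. (poly_norm (P i))\<^sup>2)"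
      using assms(1) by (intro sum_pos) auto
    then show ?thesis
      by (simp add: system_norm_def)
  qed
  have d_le: "poly_deg (P i) \<le> D" if "i \<in> {1..n}" for i
    using that unfolding assms(4) assms(3)[OF that, symmetric] by (intro Max_ge) auto
  have S_poly: "?S $ \<iota> i $ \<iota> i = complex_of_real
      (sqrt (real (poly_deg (P i))) * norm_one X ^ (poly_deg (P i) - 1) * ?p)" if "i \<in> {1..n}" for i
  proof -
    have "position n m \<iota> (\<iota> i) = i"
      using that by (intro position_eq \<iota>) auto
    with that show ?thesis
      by (simp add: scaling_matrix_def)
  qed
  have S_exp: "?S $ \<iota> (n + j) $ \<iota> (n + j) = 1" if "j \<in> {1..m}" for j
  proof -
    have "position n m \<iota> (\<iota> (n + j)) = n + j"
      using that by (intro position_eq \<iota>) auto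
    with that show ?thesis
      by (simp add: scaling_matrix_def)
  qed
  have S_off: "?S $ k $ l = 0" if "l \<noteq> k" for k l
    using that by (simp add: scaling_matrix_def)
  have S_nz: "?S $ k $ k \<noteq> 0" for k
  proof -
    define i where "i = position n m \<iota> k"
    have i: "i \<in> {1..n+m}" "k = \<iota> i"
      using position_mem[OF \<iota>, of k] by (simp_all add: i_def)
    show ?thesis
    proof (cases "i \<le> n")
      case True
      then have "i \<in> {1..n}"
        using i by simp
      with d_pos[OF this] p_pos norm_one_pos[of X] show ?thesis
        unfolding i(2) by (simp add: S_poly)
    next
      case False
      then have "i - n \<in> {1..m}" "n + (i - n) = i"
        using i by auto
      then show ?thesis
        unfolding i(2) by (metis S_exp zero_neq_one)
    qed
  qed
  have bound: "norm ((?L *v higher_deriv vs ?F X) /\<^sub>R fact k) \<le> (?\<mu> * T) ^ (k - 1)"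
    if k: "2 \<le> k" and vs: "length vs = k" "\<forall>v\<in>set vs. norm v \<le> 1" for k vs
  proof -
    \<comment> \<open>The inverse of the scaling matrix applied to the \<open>k\<close>-th
      derivative over \<open>fact k\<close>, written entrywise as the matrix is diagonal.\<close>
    define w where "w = (\<chi> l. higher_deriv vs ?F X $ l / ?S $ l $ l / fact k)"
    have "(?S *v w) $ l = higher_deriv vs ?F X $ l / fact k" for l
    proof -
      have "(?S *v w) $ l = (\<Sum>j\<in>UNIV. if j = l then ?S $ l $ l * w $ l else 0)"
        unfolding matrix_vector_mult_def vec_lambda_beta by (intro sum.cong) (auto simp: S_off)
      then show ?thesis
        using S_nz[of l] by (simp add: w_def)
    qed
    then have Sw: "?S *v w = higher_deriv vs ?F X /\<^sub>R fact k"
      by (simp add: vec_eq_iff scaleR_conv_of_real[where 'a=complex] divide_inverse mult.commute)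
    \<comment> \<open>The ratios \<open>poly_norm (P i) / ?p\<close> have squares with sum 1, so all
      polynomial rows together cost a single \<open>A ^ (k - 1)\<close>.\<close>
    have poly_part: "(\<Sum>i=1..n. (cmod (w $ \<iota> i))\<^sup>2) \<le> (A ^ (k - 1))\<^sup>2"
    proof -
      have "cmod (w $ \<iota> i) \<le> poly_norm (P i) / ?p * A ^ (k - 1)" if i: "i \<in> {1..n}" for i
      proof -
        have "cmod (w $ \<iota> i) = cmod (poly_derivs (poly_deg (P i)) (Poly_Mapping.lookup (P i)) vs X) /
            (sqrt (real (poly_deg (P i))) * norm_one X ^ (poly_deg (P i) - 1) * ?p) / fact k"
          using p_pos norm_one_pos[of X]
          by (simp add: w_def hd_poly[OF i] S_poly[OF i] norm_divide norm_mult norm_power)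
        also have "\<dots> \<le> poly_norm (P i) / ?p * A ^ (k - 1)"
          unfolding A_def poly_norm_eq_bw_norm
          by (intro scaled_poly_derivs_le d_pos[OF i] d_le[OF i] k vs p_pos)
        finally show ?thesis .
      qed
      then have "(\<Sum>i=1..n. (cmod (w $ \<iota> i))\<^sup>2) \<le> (\<Sum>i=1..n. (poly_norm (P i) / ?p * A ^ (k - 1))\<^sup>2)"
        by (intro sum_mono power_mono) auto
      also have "\<dots> = (\<Sum>i=1..n. (poly_norm (P i))\<^sup>2) / ?p\<^sup>2 * (A ^ (k - 1))\<^sup>2"
        by (simp add: power_mult_distrib power_divide sum_distrib_right sum_divide_distrib)
      also have "(\<Sum>i=1..n. (poly_norm (P i))\<^sup>2) = ?p\<^sup>2"
        by (simp add: system_norm_def sum_nonneg)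
      finally show ?thesis
        using p_pos by simp
    qed
    have exp_part: "cmod (w $ \<iota> (n + j)) \<le> \<beta> j ^ (k - 1)" if j: "j \<in> {1..m}" for j
    proof -
      let ?s = "\<iota> (\<sigma> j)"
      \<comment> \<open>With at least two directions the linear term of the row has
        vanished.\<close>
      obtain v u us where "vs = v # u # us"
        using k vs(1) by (metis Suc_le_length_iff numeral_2_eq_2)
      then have "exp_derivs (\<iota> (n + j)) ?s (g j) vs X =
          - ((deriv ^^ k) (g j) (X $ ?s) * (\<Prod>v\<leftarrow>vs. v $ ?s))"
        using vs(1) by (simp add: exp_derivs_def)
      moreover have "cmod (\<Prod>v\<leftarrow>vs. v $ ?s) \<le> 1"
        using vs(2)
      proof (induction vs)
        case (Cons v vs)
        then have "cmod (v $ ?s) \<le> 1"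
          using Finite_Cartesian_Product.norm_nth_le[of v ?s] by (auto intro: order_trans)
        with Cons show ?case
          by (simp add: norm_mult mult_le_one)
      qed simp
      ultimately have "cmod (exp_derivs (\<iota> (n + j)) ?s (g j) vs X) \<le> cmod ((deriv ^^ k) (g j) (X $ ?s))"
        by (simp add: norm_mult mult_left_le)
      then have "cmod (w $ \<iota> (n + j)) \<le> cmod ((deriv ^^ k) (g j) (X $ ?s)) / fact k"
        by (simp add: w_def hd_exp[OF j] S_exp[OF j] norm_divide divide_right_mono)
      also have "\<dots> \<le> \<beta> j ^ (k - 1)"
        unfolding \<beta>_def
        using assms(7)[OF j] ode_order_pos assms(8)[OF j]
        by (intro higher_deriv_fact_le assms(5)[OF j] assms(9)[OF j] k) auto
      finally show ?thesis .
    qed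
    have "norm w \<le> A ^ (k - 1) + (\<Sum>j=1..m. \<beta> j ^ (k - 1))"
      by (rule norm_le_split[OF \<iota> poly_part exp_part]) (use A in simp_all)
    also have "\<dots> \<le> T ^ (k - 1)"
    proof -
      obtain q where q: "k - 1 = Suc q"
        using k by (intro that[of "k - 2"]) linarith
      have "A ^ (k - 1) + (\<Sum>j=1..m. \<beta> j ^ (k - 1)) = A * A ^ q + (\<Sum>j=1..m. \<beta> j * \<beta> j ^ q)"
        by (simp only: q power_Suc)
      \<comment> \<open>In each power all factors but one are enlarged to \<open>T\<close>; the
        single factors left over add up to \<open>T\<close>.\<close>
      also have "\<dots> \<le> A * T ^ q + (\<Sum>j=1..m. \<beta> j * T ^ q)"
        using A \<beta> T by (intro add_mono sum_mono mult_left_mono power_mono) auto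
      also have "\<dots> = T ^ (k - 1)"
        by (simp only: q power_Suc T_def distrib_right sum_distrib_right)
      finally show ?thesis .
    qed
    finally have w: "norm w \<le> T ^ (k - 1)" .
    have \<mu>: "1 \<le> ?\<mu>" "matrix_norm (?L ** ?S) \<le> ?\<mu>"
      by (simp_all add: mu_def)
    have "(?L *v higher_deriv vs ?F X) /\<^sub>R fact k = (?L ** ?S) *v w"
      by (simp add: matrix_vector_mul_assoc[symmetric] Sw linear_cmul[OF matrix_vector_mul_linear])
    then have "norm ((?L *v higher_deriv vs ?F X) /\<^sub>R fact k) \<le> matrix_norm (?L ** ?S) * norm w"
      unfolding matrix_norm_def
      using onorm[OF matrix_vector_mul_bounded_linear, of "?L ** ?S" w] by (simp only:)
    also have "\<dots> \<le> ?\<mu> ^ (k - 1) * T ^ (k - 1)"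
    proof (rule mult_mono[OF _ w])
      \<comment> \<open>Here the maximum with 1 in \<open>mu\<close> enters, together with
        \<open>1 \<le> k - 1\<close>.\<close>
      show "matrix_norm (?L ** ?S) \<le> ?\<mu> ^ (k - 1)"
        using \<mu> k self_le_power[of ?\<mu> "k - 1"] by auto
    qed (use \<mu> in simp_all)
    finally show ?thesis
      by (simp add: power_mult_distrib)
  qed
  have "gamma_fn ?F X \<le> ereal (?\<mu> * T)"
    unfolding gamma_fn_def
  proof (rule SUP_least)
    fix k :: nat assume "k \<in> {2..}"
    then have k: "2 \<le> k"
      by simp
    let ?V = "{vs :: (complex^'N) list. length vs = k \<and> (\<forall>v\<in>set vs. norm v \<le> 1)}"
    let ?M = "\<lambda>vs. norm ((?L *v higher_deriv vs ?F X) /\<^sub>R fact k)"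
    \<comment> \<open>The supremum in \<open>multilinear_norm\<close> is a real one, so its index
      set must be nonempty and its values bounded above; its sign is needed for the monotonicity of
      \<open>powr\<close>.\<close>
    have zero: "replicate k 0 \<in> ?V"
      by simp
    have le: "?M vs \<le> (?\<mu> * T) ^ (k - 1)" if "vs \<in> ?V" for vs
      using bound[OF k] that by blast
    then have "bdd_above (?M ` ?V)"
      by (rule bdd_aboveI2)
    then have nonneg: "0 \<le> (SUP vs\<in>?V. ?M vs)"
      by (rule cSUP_upper2[OF _ zero]) simp
    have \<mu>T: "0 \<le> ?\<mu> * T"
      using T(2) by (simp add: mu_def)
    have "(SUP vs\<in>?V. ?M vs) \<le> (?\<mu> * T) ^ (k - 1)"
      by (rule cSUP_least[OF _ le]) (use zero in blast)+
    then have "(SUP vs\<in>?V. ?M vs) powr (1 / (real k - 1)) \<le> ((?\<mu> * T) ^ (k - 1)) powr (1 / (real k - 1))"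
      using nonneg k by (intro powr_mono2) auto
    also have "\<dots> = ?\<mu> * T"
      by (rule power_powr_inverse[OF \<mu>T k])
    finally show "ereal (multilinear_norm k (\<lambda>vs. (?L *v higher_deriv vs ?F X) /\<^sub>R fact k)
        powr (1 / (real k - 1))) \<le> ereal (?\<mu> * T)"
      by (simp add: multilinear_norm_def)
  qed
  also have "?\<mu> * T = ?\<mu> * (real D powr (3/2) / (2 * norm_one X) +
       2 * (\<Sum>i=1..m. (C_bound (c i) (r i))\<^sup>2 *
                      max 1 (real (r i) * B_bound (g i) (r i) (X $ \<iota> (\<sigma> i)))))"
    by (simp add: T_def A_def \<beta>_def sum_distrib_left)
  finally show ?thesis .
qed

end
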